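(* For $\alpha\in(0,1]$ let $\xi=(\xi_k)_{k\ge 0}$ be a collection of independent Poisson point processes on $[0,1]$, each with intensity $\alpha$, and let $D\in\{1,2,\dots\}\cup\{\infty\}$ be the number of vertices of the bump tree $\gamma(\xi)$. Write $\mathbf{E}_\alpha$ for the corresponding expectation. Then for $0<\alpha<1$, $$\mathbf{E}_\alpha[D]=\frac{1}{1-\alpha},$$ and $\mathbf{E}_1[D]$ diverges, i.e. $\mathbf{E}_1[D]=+\infty$.
   Context: A point process on $[0,1]$ is an integer-valued measure on the Borel sets of $[0,1]$, viewed as a collection of points (its atoms). A Poisson point process on $[0,1]$ with intensity $\alpha$ is a random such measure for which the number of atoms in a Borel set $E$ of Lebesgue measure $\lambda$ is Poisson with mean $\alpha\lambda$, and the numbers of atoms in disjoint Borel sets are independent. A point process configuration is a sequence $\xi=(\xi_k)_{k\ge0}$ of point processes on $[0,1]$. For an atom $x\in\xi_0$, the bump map is $f(\xi,x)=(\xi'_k)_{k\ge0}$, where $\xi'_k=\xi_{k+1}|_{[0,x)}+\xi_k|_{(x,1]}$ (the atoms of $\xi_{k+1}$ in $[0,x)$ together with the atoms of $\xi_k$ in $(x,1]$). The bump tree $\gamma(\xi)$ is the rooted tree defined recursively, each vertex $v$ carrying a configuration $\xi^v$: the root $v_0$ carries $\xi^{v_0}=\xi$; a vertex $v$ has exactly one child $v(x)$ for each atom $x\in\xi^v_0$, and this child carries $\xi^{v(x)}=f(\xi^v,x)$. (Almost surely all atoms of $\xi$ are at distinct locations.) *)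

theory Defs
  imports "HOL-Probability.Probability"
begin

abbreviation unit_borel :: "real measure" where
  "unit_borel \<equiv> restrict_space borel {0..1}"

text \<open>
  A configuration of points is a measure on the Borel sets of the unit interval all of whose
  values are natural numbers; infinity is not a value, so only finitely many points occur.
  The sigma-algebra on these measures is the usual one, generated by the evaluation maps at
  Borel sets (as in the library's \<^const>\<open>subprob_algebra\<close>, which is
  confined to measures of total mass at most one).
\<close>

definition counting_measures :: "real measure set" where
  "counting_measures =
     {\<mu>. sets \<mu> = sets unit_borel \<and> (\<forall>E\<in>sets unit_borel. emeasure \<mu> E \<in> range of_nat)}"

definition counting_algebra :: "real measure measure" where
  "counting_algebra =
     (SUP E\<in>sets unit_borel. vimage_algebra counting_measures (\<lambda>\<mu>. emeasure \<mu> E) borel)"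

text \<open>
  In the last clause a sequence of disjoint sets covers finite families as well, since
  all but finitely many of the sets may be empty.
\<close>

definition poisson_point_process ::
  "'w measure \<Rightarrow> real \<Rightarrow> ('w \<Rightarrow> real measure) \<Rightarrow> bool" where
  "poisson_point_process M \<alpha> N \<longleftrightarrow>
     N \<in> measurable M counting_algebra \<and>
     (\<forall>E\<in>sets unit_borel. \<forall>n::nat.
        measure M {\<omega>\<in>space M. emeasure (N \<omega>) E = of_nat n} =
          exp (- (\<alpha> * measure lborel E)) * (\<alpha> * measure lborel E) ^ n / fact n) \<and>
     (\<forall>E::nat \<Rightarrow> real set. disjoint_family E \<longrightarrow> range E \<subseteq> sets unit_borel \<longrightarrow>
        prob_space.indep_vars M (\<lambda>_. borel) (\<lambda>i \<omega>. emeasure (N \<omega>) (E i)) UNIV)"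

definition atoms :: "real measure \<Rightarrow> real set" where
  "atoms \<mu> = {x \<in> space \<mu>. emeasure \<mu> {x} \<noteq> 0}"

definition bump :: "(nat \<Rightarrow> real measure) \<Rightarrow> real \<Rightarrow> nat \<Rightarrow> real measure" where
  "bump \<xi> x k = measure_of {0..1} (sets unit_borel)
     (\<lambda>E. emeasure (\<xi> (Suc k)) (E \<inter> {0..<x}) + emeasure (\<xi> k) (E \<inter> {x<..1}))"

text \<open>
  A vertex of the bump tree is represented by the list of atoms chosen along the path from
  the root to it; its parent is obtained by removing the last entry.  Two distinct paths are
  distinct vertices even if they carry the same configuration.
\<close>

definition vertex_config :: "(nat \<Rightarrow> real measure) \<Rightarrow> real list \<Rightarrow> nat \<Rightarrow> real measure" where
  "vertex_config \<xi> v = foldl bump \<xi> v"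

inductive_set bump_tree :: "(nat \<Rightarrow> real measure) \<Rightarrow> real list set"
  for \<xi> :: "nat \<Rightarrow> real measure" where
  root: "[] \<in> bump_tree \<xi>"
| child: "v \<in> bump_tree \<xi> \<Longrightarrow> x \<in> atoms (vertex_config \<xi> v 0) \<Longrightarrow> v @ [x] \<in> bump_tree \<xi>"

definition bump_tree_size :: "(nat \<Rightarrow> real measure) \<Rightarrow> ennreal" where
  "bump_tree_size \<xi> = emeasure (count_space UNIV) (bump_tree \<xi>)"

lemma space_counting_algebra: "space counting_algebra = counting_measures"
proof -
  have "{} \<in> sets unit_borel" by simp
  then show ?thesis
    unfolding counting_algebra_def by (subst space_Sup_eq_UN) auto
qed

lemma emeasure_bump:
  assumes "\<xi> k \<in> counting_measures" "\<xi> (Suc k) \<in> counting_measures"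
    and E: "E \<in> sets unit_borel"
  shows "emeasure (bump \<xi> x k) E =
    emeasure (\<xi> (Suc k)) (E \<inter> {0..<x}) + emeasure (\<xi> k) (E \<inter> {x<..1})"
proof -
  let ?f = "\<lambda>E. emeasure (\<xi> (Suc k)) (E \<inter> {0..<x}) + emeasure (\<xi> k) (E \<inter> {x<..1})"
  have sets: "sets (\<xi> k) = sets unit_borel" "sets (\<xi> (Suc k)) = sets unit_borel"
    using assms by (auto simp: counting_measures_def)
  have Int: "A \<inter> B \<in> sets unit_borel" if "A \<in> sets unit_borel" "B \<in> sets borel" for A B :: "real set"
    using that by (auto simp: sets_restrict_space_iff)
  have "countably_additive (sets unit_borel) ?f"
  proof (rule countably_additiveI)
    fix A :: "nat \<Rightarrow> real set"
    assume A: "range A \<subseteq> sets unit_borel" "disjoint_family A"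
    have *: "(\<Sum>i. emeasure \<mu> (A i \<inter> B)) = emeasure \<mu> ((\<Union>i. A i) \<inter> B)"
      if "sets \<mu> = sets unit_borel" "B \<in> sets borel" for \<mu> B
    proof -
      have "range (\<lambda>i. A i \<inter> B) \<subseteq> sets \<mu>"
        using A(1) Int[OF _ that(2)] that(1) by auto
      moreover have "disjoint_family (\<lambda>i. A i \<inter> B)"
        using A(2) by (auto simp: disjoint_family_on_def)
      ultimately show ?thesis
        by (subst suminf_emeasure) (auto simp: Int_UN_distrib2)
    qed
    show "(\<Sum>i. ?f (A i)) = ?f (\<Union>i. A i)"
      by (subst suminf_add[symmetric]) (auto simp: * sets)
  qed
  moreover have "positive (sets unit_borel) ?f"
    by (simp add: positive_def)
  moreover have "sigma_algebra {0..1} (sets unit_borel)"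
    using sets.sigma_algebra_axioms[of unit_borel] by (simp add: space_restrict_space)
  ultimately show ?thesis
    unfolding bump_def using E by (intro emeasure_measure_of_sigma) auto
qed

lemma bump_in_counting_measures:
  assumes "\<xi> k \<in> counting_measures" "\<xi> (Suc k) \<in> counting_measures"
  shows "bump \<xi> x k \<in> counting_measures"
proof -
  have alg: "sigma_algebra {0..1} (sets unit_borel)"
    using sets.sigma_algebra_axioms[of unit_borel] by (simp add: space_restrict_space)
  have "sets (bump \<xi> x k) = sets unit_borel"
    unfolding bump_def using alg by (simp add: sigma_algebra.sets_measure_of_eq)
  moreover have "emeasure (bump \<xi> x k) E \<in> range of_nat" if E: "E \<in> sets unit_borel" for E
  proof -
    have "E \<inter> {0..<x} \<in> sets unit_borel" "E \<inter> {x<..1} \<in> sets unit_borel"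
      using E by (auto simp: sets_restrict_space_iff)
    then obtain m n :: nat where
      "emeasure (\<xi> (Suc k)) (E \<inter> {0..<x}) = of_nat m" "emeasure (\<xi> k) (E \<inter> {x<..1}) = of_nat n"
      using assms unfolding counting_measures_def by fast
    then have "emeasure (bump \<xi> x k) E = of_nat (m + n)"
      by (simp add: emeasure_bump[OF assms E])
    then show ?thesis by blast
  qed
  ultimately show ?thesis by (simp add: counting_measures_def)
qed

end

theory Submission
  imports Defs "HOL-Real_Asymp.Real_Asymp"
begin

text \<open>
  A bump at \<open>x\<close> shifts the index of the processes by one to the left of \<open>x\<close> and deletes what lies at
  \<open>x\<close>.  So a list of \<open>n\<close> points is a vertex of depth \<open>n\<close> iff the points are distinct and each one is
  an atom of \<open>\<xi> c\<close>, where \<open>c\<close> counts the earlier points to its right.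

  Cut the unit interval into \<open>N + 1\<close> cells of equal length and count the lists of \<open>n\<close> distinct cells
  each of which is charged by the process prescribed by the order of the cells.  This count never
  exceeds the number of vertices of depth \<open>n\<close>, and equals it once the cells separate the finitely
  many atoms of the first \<open>n\<close> processes.  The cells of a list being disjoint, the events are
  independent, so the expected count is
  \<open>(N + 1) N \<dots> (N + 2 - n) (1 - exp (- \<alpha> / (N + 1)))^n\<close>, which tends to \<open>\<alpha>^n\<close>.  By Fatou's lemma and
  the upper bound, \<open>\<alpha>^n\<close> is the expected number of vertices of depth \<open>n\<close>; sum over \<open>n\<close>.
\<close>

section \<open>Counting measures and their atoms\<close>

lemma counting_measures_space:
  assumes "\<mu> \<in> counting_measures"
  shows "space \<mu> = {0..1}"
  using assms sets_eq_imp_space_eq[of \<mu> unit_borel]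
  by (auto simp: counting_measures_def space_restrict_space)

lemma counting_measures_sets:
  assumes "\<mu> \<in> counting_measures"
  shows "sets \<mu> = sets unit_borel"
  using assms by (auto simp: counting_measures_def)

lemma counting_measures_emeasure:
  assumes "\<mu> \<in> counting_measures" "E \<in> sets unit_borel"
  obtains n :: nat where "emeasure \<mu> E = of_nat n"
  using assms unfolding counting_measures_def by blast

text \<open>Integrality leaves no value strictly between 0 and 1. This gap survives limits of
  decreasing sets and bounds the number of atoms.\<close>

lemma counting_measures_ge_1:
  assumes "\<mu> \<in> counting_measures" "E \<in> sets unit_borel" "emeasure \<mu> E \<noteq> 0"
  shows "1 \<le> emeasure \<mu> E"
proof -
  obtain n :: nat where n: "emeasure \<mu> E = of_nat n"
    using assms counting_measures_emeasure by blast
  with assms(3) have "1 \<le> n" by (cases n) auto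
  then show ?thesis
    unfolding n using of_nat_mono[of 1 n, where 'a = ennreal] by simp
qed

text \<open>Each atom weighs at least 1 and the total mass is a natural number, which bounds the
  size of every finite set of atoms.\<close>

lemma finite_atoms:
  assumes \<mu>: "\<mu> \<in> counting_measures"
  shows "finite (atoms \<mu>)"
proof -
  have "{0..1} \<in> sets unit_borel" by (simp add: sets_restrict_space_iff)
  then obtain n :: nat where n: "emeasure \<mu> {0..1} = of_nat n"
    using counting_measures_emeasure[OF \<mu>] by blast
  have single: "{x} \<in> sets \<mu>" if "x \<in> atoms \<mu>" for x
    using that counting_measures_space[OF \<mu>]
    by (auto simp: atoms_def counting_measures_sets[OF \<mu>] sets_restrict_space_iff)
  have "card F \<le> n" if F: "finite F" "F \<subseteq> atoms \<mu>" for F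
  proof -
    have "of_nat (card F) = (\<Sum>x\<in>F. 1::ennreal)" by simp
    also have "\<dots> \<le> (\<Sum>x\<in>F. emeasure \<mu> {x})"
    proof (rule sum_mono)
      fix x assume "x \<in> F"
      with F have x: "x \<in> atoms \<mu>" by blast
      then show "1 \<le> emeasure \<mu> {x}"
        using counting_measures_ge_1[OF \<mu>] single[OF x]
        by (simp add: atoms_def counting_measures_sets[OF \<mu>])
    qed
    also have "\<dots> = emeasure \<mu> F"
      using F single by (intro emeasure_eq_sum_singleton[symmetric]) auto
    also have "\<dots> \<le> emeasure \<mu> {0..1}"
      using emeasure_space[of \<mu> F] by (simp add: counting_measures_space[OF \<mu>])
    finally show ?thesis unfolding n by simp
  qed
  then show ?thesis
    by (meson finite_if_finite_subsets_card_bdd)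
qed

text \<open>The atom is found at the supremum of the levels below which the set carries no mass.\<close>

lemma emeasure_nonzero_iff_atom:
  assumes \<mu>: "\<mu> \<in> counting_measures" and E: "E \<in> sets unit_borel"
  shows "emeasure \<mu> E \<noteq> 0 \<longleftrightarrow> (\<exists>x\<in>E. x \<in> atoms \<mu>)"
proof
  assume "\<exists>x\<in>E. x \<in> atoms \<mu>"
  then obtain x where x: "x \<in> E" "emeasure \<mu> {x} \<noteq> 0" by (auto simp: atoms_def)
  have "emeasure \<mu> {x} \<le> emeasure \<mu> E"
    using x E by (intro emeasure_mono) (auto simp: counting_measures_sets[OF \<mu>])
  with x show "emeasure \<mu> E \<noteq> 0" by auto
next
  assume nz: "emeasure \<mu> E \<noteq> 0"
  have E01: "E \<subseteq> {0..1}" and Eb: "E \<in> sets borel"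
    using E by (auto simp: sets_restrict_space_iff)
  have sets: "E \<inter> B \<in> sets \<mu>" if "B \<in> sets borel" for B
    using that E by (auto simp: counting_measures_sets[OF \<mu>] sets_restrict_space_iff)
  define S where "S = {t. emeasure \<mu> (E \<inter> {..<t}) = 0}"
  have "E \<inter> {..<0} = {}" using E01 by auto
  then have S0: "0 \<in> S" by (simp add: S_def)
  \<comment> \<open>A half-line reaching beyond the unit interval contains all of \<open>E\<close>,
    which has positive mass; the value 2 is merely convenient.\<close>
  have Sle: "t \<le> 2" if "t \<in> S" for t
  proof (rule ccontr)
    assume "\<not> t \<le> 2"
    then have "E \<inter> {..<t} = E" using E01 by force
    with that nz show False by (simp add: S_def)
  qed
  then have bdd: "bdd_above S" by (intro bdd_aboveI[of _ 2]) auto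
  define s where "s = Sup S"
  have down: "u \<in> S" if "t \<in> S" "u \<le> t" for t u
  proof -
    have "emeasure \<mu> (E \<inter> {..<u}) \<le> emeasure \<mu> (E \<inter> {..<t})"
      using that sets by (intro emeasure_mono) auto
    with that show ?thesis by (simp add: S_def)
  qed
  have below: "t \<in> S" if "t < s" for t
    using that less_cSup_iff[OF _ bdd, of t] S0 down unfolding s_def
    by (metis empty_iff less_imp_le)
  have above: "t \<notin> S" if "s < t" for t
    using that cSup_upper[OF _ bdd, of t] unfolding s_def by auto
  have 1: "emeasure \<mu> (E \<inter> {..<s}) = 0"
  proof -
    have eq: "E \<inter> {..<s} = (\<Union>n. E \<inter> {..<s - 1 / Suc n})"
    proof (intro equalityI subsetI)
      fix x assume x: "x \<in> E \<inter> {..<s}"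
      then obtain n where "1 / Suc n < s - x"
        using reals_Archimedean[of "s - x"] by (auto simp: inverse_eq_divide)
      then have "x < s - 1 / Suc n" by linarith
      with x show "x \<in> (\<Union>n. E \<inter> {..<s - 1 / Suc n})" by blast
    qed (auto intro: less_le_trans)
    have "(\<Union>n. E \<inter> {..<s - 1 / Suc n}) \<in> null_sets \<mu>"
      using below sets by (intro null_sets_UN) (auto simp: null_sets_def S_def)
    then show ?thesis unfolding eq by (auto simp: null_sets_def)
  qed
  have fin: "emeasure \<mu> (E \<inter> B) \<noteq> \<infinity>" if "B \<in> sets borel" for B
    using counting_measures_emeasure[OF \<mu>, of "E \<inter> B"] sets[OF that]
    by (metis counting_measures_sets[OF \<mu>] ennreal_of_nat_neq_top infinity_ennreal_def)
  \<comment> \<open>Continuity from above: the masses just beyond \<open>s\<close> are nonzero,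
    hence at least 1, and the bound passes to the limit.\<close>
  have 2: "1 \<le> emeasure \<mu> (E \<inter> {..s})"
  proof -
    have eq: "(\<Inter>n. E \<inter> {..<s + 1 / Suc n}) = E \<inter> {..s}"
    proof (intro equalityI subsetI)
      fix x assume x: "x \<in> (\<Inter>n. E \<inter> {..<s + 1 / Suc n})"
      have "x \<le> s"
      proof (rule ccontr)
        assume "\<not> x \<le> s"
        then obtain n where "1 / Suc n < x - s"
          using reals_Archimedean[of "x - s"] by (auto simp: inverse_eq_divide)
        with x show False by (auto dest!: spec[of _ n])
      qed
      with x show "x \<in> E \<inter> {..s}" by auto
    qed (auto intro: le_less_trans)
    have "(\<lambda>n. emeasure \<mu> (E \<inter> {..<s + 1 / Suc n})) \<longlonglongrightarrow> emeasure \<mu> (\<Inter>n. E \<inter> {..<s + 1 / Suc n})"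
    proof (rule Lim_emeasure_decseq)
      show "range (\<lambda>n. E \<inter> {..<s + 1 / Suc n}) \<subseteq> sets \<mu>" using sets by auto
      have "1 / real (Suc n) \<le> 1 / real (Suc m)" if "m \<le> n" for m n
        using that by (simp add: frac_le)
      then show "decseq (\<lambda>n. E \<inter> {..<s + 1 / Suc n})"
        unfolding decseq_def by fastforce
      show "emeasure \<mu> (E \<inter> {..<s + 1 / Suc n}) \<noteq> \<infinity>" for n by (rule fin) simp
    qed
    moreover have "1 \<le> emeasure \<mu> (E \<inter> {..<s + 1 / Suc n})" for n
    proof (rule counting_measures_ge_1[OF \<mu>])
      show "E \<inter> {..<s + 1 / Suc n} \<in> sets unit_borel"
        using sets counting_measures_sets[OF \<mu>] by auto
      show "emeasure \<mu> (E \<inter> {..<s + 1 / Suc n}) \<noteq> 0"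
        using above[of "s + 1 / Suc n"] by (auto simp: S_def)
    qed
    ultimately show ?thesis unfolding eq by (intro LIMSEQ_le_const) auto
  qed
  \<comment> \<open>The mass jumps from 0 to at least 1 when \<open>s\<close> itself is included, so
    the point \<open>s\<close> carries it.\<close>
  have "emeasure \<mu> (E \<inter> {..s}) = emeasure \<mu> (E \<inter> {..<s} \<union> E \<inter> {s})"
    by (rule arg_cong[where f = "emeasure \<mu>"]) auto
  also have "\<dots> \<le> emeasure \<mu> (E \<inter> {..<s}) + emeasure \<mu> (E \<inter> {s})"
    using sets by (intro emeasure_subadditive) auto
  finally have "emeasure \<mu> (E \<inter> {s}) \<noteq> 0" using 1 2 by auto
  moreover from this have "s \<in> E" by (cases "s \<in> E") auto
  ultimately show "\<exists>x\<in>E. x \<in> atoms \<mu>"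
    using E01 by (intro bexI[of _ s]) (auto simp: atoms_def counting_measures_space[OF \<mu>])
qed

section \<open>Vertices as lists of points\<close>

text \<open>Each bump to the right of \<open>y\<close> raises by one the index of the process seen
  at \<open>y\<close>; this is the total shift. The order is left general so that the same count
  serves points and cell numbers.\<close>

definition num_above :: "'a::linorder list \<Rightarrow> 'a \<Rightarrow> nat" where
  "num_above v y = length (filter (\<lambda>z. y < z) v)"

lemma num_above_le: "num_above v y \<le> length v"
  by (simp add: num_above_def)

lemma num_above_map:
  assumes "\<And>z. z \<in> set v \<Longrightarrow> f y < f z \<longleftrightarrow> y < z"
  shows "num_above (map f v) (f y) = num_above v y"
  using assms by (auto simp: num_above_def filter_map o_def intro!: arg_cong[where f = length] filter_cong)

lemma vertex_config_in_counting_measures: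
  assumes "\<And>k. \<xi> k \<in> counting_measures"
  shows "vertex_config \<xi> v k \<in> counting_measures"
proof (induction v arbitrary: k rule: rev_induct)
  case Nil
  then show ?case using assms by (simp add: vertex_config_def)
next
  case (snoc x v)
  then show ?case
    using bump_in_counting_measures[of "vertex_config \<xi> v"] by (simp add: vertex_config_def)
qed

text \<open>Induction from the end of the list, since \<open>foldl\<close> applies the last bump
  outermost. A bump at \<open>x\<close> replaces \<open>k\<close> by \<open>Suc k\<close> left of
  \<open>x\<close>, keeps \<open>k\<close> right of \<open>x\<close> and deletes \<open>x\<close>
  itself; hence \<open>k\<close> stays arbitrary.\<close>

lemma emeasure_vertex_config_singleton:
  assumes "\<And>k. \<xi> k \<in> counting_measures" "y \<in> {0..1}"
  shows "emeasure (vertex_config \<xi> v k) {y} =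
    (if y \<in> set v then 0 else emeasure (\<xi> (k + num_above v y)) {y})"
proof (induction v arbitrary: k rule: rev_induct)
  case Nil
  then show ?case by (simp add: vertex_config_def num_above_def)
next
  case (snoc x v)
  have y: "{y} \<in> sets unit_borel" using assms by (simp add: sets_restrict_space_iff)
  have *: "emeasure (vertex_config \<xi> (v @ [x]) k) {y} =
      emeasure (vertex_config \<xi> v (Suc k)) ({y} \<inter> {0..<x}) +
      emeasure (vertex_config \<xi> v k) ({y} \<inter> {x<..1})"
    using emeasure_bump[of "vertex_config \<xi> v" k, OF _ _ y]
      vertex_config_in_counting_measures[of \<xi>, OF assms(1)]
    by (simp add: vertex_config_def)
  consider "y < x" | "y = x" | "x < y" by linarith
  then show ?case
  proof cases
    case 1
    then show ?thesis using assms(2) snoc by (simp add: * num_above_def)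
  next
    case 2
    then show ?thesis unfolding * by simp
  next
    case 3
    then show ?thesis using assms(2) snoc by (simp add: * num_above_def)
  qed
qed

lemma bump_tree_snoc:
  "v @ [x] \<in> bump_tree \<xi> \<longleftrightarrow> v \<in> bump_tree \<xi> \<and> x \<in> atoms (vertex_config \<xi> v 0)"
  by (auto intro: bump_tree.child elim: bump_tree.cases)

text \<open>The singleton formula at index 0 tells which points extend a path: those not chosen
  before that are atoms of the process with the shifted index. Membership is thus reduced to the
  atoms of \<open>\<xi>\<close> itself.\<close>

lemma bump_tree_iff:
  assumes "\<And>k. \<xi> k \<in> counting_measures"
  shows "v \<in> bump_tree \<xi> \<longleftrightarrow>
    distinct v \<and> (\<forall>m<length v. v ! m \<in> atoms (\<xi> (num_above (take m v) (v ! m))))"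
proof (induction v rule: rev_induct)
  case Nil
  then show ?case by (simp add: bump_tree.root)
next
  case (snoc x v)
  have "x \<in> atoms (vertex_config \<xi> v 0) \<longleftrightarrow> x \<notin> set v \<and> x \<in> atoms (\<xi> (num_above v x))"
    using emeasure_vertex_config_singleton[of \<xi>, OF assms, of x v 0]
      counting_measures_space[OF assms]
      counting_measures_space[OF vertex_config_in_counting_measures[of \<xi>, OF assms]]
    by (auto simp: atoms_def split: if_splits)
  then show ?case
    by (auto simp: bump_tree_snoc snoc nth_append less_Suc_eq)
qed

section \<open>Partition of the unit interval into cells\<close>

text \<open>On the unit interval \<open>min\<close> acts only at \<open>x = 1\<close>, where the
  floor is \<open>N + 1\<close>: the right endpoint joins the last cell.\<close>

definition cell :: "nat \<Rightarrow> real \<Rightarrow> nat" where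
  "cell N x = min N (nat \<lfloor>real (Suc N) * x\<rfloor>)"

definition cell_set :: "nat \<Rightarrow> nat \<Rightarrow> real set" where
  "cell_set N i = {x \<in> {0..1}. cell N x = i}"

lemma cell_le: "cell N x \<le> N"
  by (simp add: cell_def)

lemma cell_mono: "x \<le> y \<Longrightarrow> cell N x \<le> cell N y"
  unfolding cell_def
  by (intro min.mono nat_mono floor_mono mult_left_mono) auto

text \<open>Monotonicity of \<open>cell\<close> suffices. This is what allows process indices to be
  read off from cell numbers.\<close>

lemma cell_less_iff:
  assumes "cell N x \<noteq> cell N y"
  shows "cell N x < cell N y \<longleftrightarrow> x < y"
  using assms cell_mono[of x y N] cell_mono[of y x N] by linarith

lemma disjoint_cell_set: "disjoint_family (cell_set N)"
  by (auto simp: disjoint_family_on_def cell_set_def)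

lemma cell_set_eq:
  assumes "i \<le> N"
  shows "cell_set N i = (if i < N then {real i / Suc N ..< real (Suc i) / Suc N} else {real N / Suc N .. 1})"
    (is "_ = ?R")
proof (rule set_eqI)
  fix x
  have le: "real i / Suc N \<le> x \<longleftrightarrow> real i \<le> real (Suc N) * x"
    and less: "x < real (Suc i) / Suc N \<longleftrightarrow> real (Suc N) * x < real (Suc i)"
    by (simp_all add: field_simps del: of_nat_Suc)
  show "x \<in> cell_set N i \<longleftrightarrow> x \<in> ?R"
  proof (cases "i < N")
    case True
    have "x \<in> cell_set N i \<longleftrightarrow> x \<in> {0..1} \<and> int i = \<lfloor>real (Suc N) * x\<rfloor>"
      using True by (auto simp: cell_set_def cell_def min_def simp del: of_nat_Suc)
    also have "\<dots> \<longleftrightarrow> x \<in> {0..1} \<and> real i \<le> real (Suc N) * x \<and> real (Suc N) * x < real (Suc i)"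
      by (auto simp: floor_eq_iff eq_commute[of "int i"] add.commute)
    also have "\<dots> \<longleftrightarrow> x \<in> ?R"
    proof -
      have "0 \<le> real i / Suc N" "real (Suc i) / Suc N \<le> 1" using True by auto
      then have "x \<in> {0..1}" if "real i / Suc N \<le> x" "x < real (Suc i) / Suc N"
        unfolding atLeastAtMost_iff using that by linarith
      then show ?thesis unfolding le[symmetric] less[symmetric] using True
        by (auto simp del: of_nat_Suc)
    qed
    finally show ?thesis .
  next
    case False
    with assms have i: "i = N" by simp
    have "x \<in> cell_set N i \<longleftrightarrow> x \<in> {0..1} \<and> int N \<le> \<lfloor>real (Suc N) * x\<rfloor>"
      by (auto simp: i cell_set_def cell_def min_def le_nat_iff simp del: of_nat_Suc)
    also have "\<dots> \<longleftrightarrow> x \<in> {0..1} \<and> real N / Suc N \<le> x"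
      using le by (simp add: i le_floor_iff del: of_nat_Suc)
    also have "\<dots> \<longleftrightarrow> x \<in> ?R"
    proof -
      have "0 \<le> real N / Suc N" by simp
      then have "0 \<le> x" if "real N / Suc N \<le> x"
        using that by (rule order_trans)
      then show ?thesis using i by (auto simp del: of_nat_Suc)
    qed
    finally show ?thesis .
  qed
qed

lemma cell_set_sets: "cell_set N i \<in> sets unit_borel"
proof (cases "i \<le> N")
  case True
  have "cell_set N i \<subseteq> {0..1}" by (auto simp: cell_set_def)
  then show ?thesis using cell_set_eq[OF True] by (auto simp: sets_restrict_space_iff)
next
  case False
  then have "cell_set N i = {}" using cell_le[of N] by (auto simp: cell_set_def)
  then show ?thesis by simp
qed

lemma measure_cell_set:
  assumes "i \<le> N"
  shows "measure lborel (cell_set N i) = 1 / Suc N"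
  unfolding cell_set_eq[OF assms]
  by (auto simp: measure_def divide_right_mono diff_divide_distrib[symmetric] field_simps)

lemma eventually_cell_neq:
  assumes "0 \<le> x" "x < y" "y \<le> 1"
  shows "\<forall>\<^sub>F N in sequentially. cell N x \<noteq> cell N y"
proof -
  have "\<forall>\<^sub>F N in sequentially. 2 / (y - x) \<le> real N"
    using filterlim_real_sequentially by (simp add: filterlim_at_top)
  then show ?thesis
  proof eventually_elim
    case (elim N)
    \<comment> \<open>A gap of 2 is arranged because truncation at \<open>N\<close> may lower the
      larger floor by one, and a difference of at least one has to remain.\<close>
    then have "2 \<le> real N * (y - x)" using assms by (simp add: field_simps)
    also have "\<dots> \<le> real (Suc N) * (y - x)" using assms by (intro mult_right_mono) auto
    finally have "real (Suc N) * x + 2 \<le> real (Suc N) * y" by (simp add: algebra_simps)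
    then have "\<lfloor>real (Suc N) * x\<rfloor> + 2 \<le> \<lfloor>real (Suc N) * y\<rfloor>" by linarith
    moreover have "real (Suc N) * y \<le> real (Suc N)"
      using assms by (intro mult_left_le) auto
    then have "\<lfloor>real (Suc N) * y\<rfloor> \<le> int (Suc N)" by linarith
    moreover have "0 \<le> \<lfloor>real (Suc N) * x\<rfloor>" using assms by simp
    ultimately show ?case unfolding cell_def by linarith
  qed
qed

lemma eventually_inj_on_cell:
  assumes "finite A" "A \<subseteq> {0..1}"
  shows "\<forall>\<^sub>F N in sequentially. inj_on (cell N) A"
proof -
  have "\<forall>\<^sub>F N in sequentially. cell N x \<noteq> cell N y" if "x \<in> A" "y \<in> A" "x \<noteq> y" for x y
  proof (cases "x < y")
    case True
    then show ?thesis using eventually_cell_neq[of x y] that assms by force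
  next
    case False
    then have "\<forall>\<^sub>F N in sequentially. cell N y \<noteq> cell N x"
      using eventually_cell_neq[of y x] that assms by force
    then show ?thesis by (rule eventually_mono) auto
  qed
  then have "\<forall>\<^sub>F N in sequentially. \<forall>x\<in>A. \<forall>y\<in>A. x \<noteq> y \<longrightarrow> cell N x \<noteq> cell N y"
    by (intro eventually_ball_finite ballI assms) auto
  then show ?thesis
    by (rule eventually_mono) (auto simp: inj_on_def)
qed

section \<open>Counting the vertices of one depth by cells\<close>

definition bump_level :: "(nat \<Rightarrow> real measure) \<Rightarrow> nat \<Rightarrow> real list set" where
  "bump_level \<xi> n = {v \<in> bump_tree \<xi>. length v = n}"

definition cell_lists :: "nat \<Rightarrow> nat \<Rightarrow> nat list set" where
  "cell_lists N n = {j. length j = n \<and> distinct j \<and> set j \<subseteq> {..N}}"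

text \<open>The condition of \<open>bump_tree_iff\<close> with cells in place of points. The process
  indices depend on \<open>j\<close> alone, so for fixed \<open>j\<close> this is an event about
  finitely many fixed counts.\<close>

definition occupied :: "(nat \<Rightarrow> real measure) \<Rightarrow> nat \<Rightarrow> nat list \<Rightarrow> bool" where
  "occupied \<xi> N j \<longleftrightarrow>
    (\<forall>m<length j. emeasure (\<xi> (num_above (take m j) (j ! m))) (cell_set N (j ! m)) \<noteq> 0)"

lemma finite_cell_lists: "finite (cell_lists N n)"
  by (rule finite_subset[OF _ finite_lists_length_eq[of "{..N}" n]]) (auto simp: cell_lists_def)

text \<open>A falling factorial, written as a real product over \<open>i < n\<close> so that each
  factor can be paired with one occupation probability in the limit.\<close>

lemma card_cell_lists:
  assumes "n \<le> Suc N"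
  shows "real (card (cell_lists N n)) = (\<Prod>i<n. real (Suc N) - real i)"
proof -
  have "card (cell_lists N n) = \<Prod>{Suc N - n + 1..Suc N}"
    using assms by (simp add: cell_lists_def card_lists_distinct_length_eq)
  also have "\<dots> = (\<Prod>i<n. Suc N - i)"
    using assms
    by (intro prod.reindex_bij_witness[of _ "\<lambda>i. Suc N - i" "\<lambda>i. Suc N - i"]) auto
  finally show ?thesis
    using assms by (auto intro!: prod.cong simp: of_nat_diff)
qed

text \<open>Points in different cells are ordered like their cells, so both lists prescribe the same
  process at each position.\<close>

lemma num_above_take_map:
  assumes "distinct v" "inj_on (cell N) (set v)" "m < length v"
  shows "num_above (take m (map (cell N) v)) (map (cell N) v ! m) = num_above (take m v) (v ! m)"
proof -
  have "cell N (v ! m) < cell N z \<longleftrightarrow> v ! m < z" if "z \<in> set (take m v)" for z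
  proof -
    have "z \<noteq> v ! m"
      using that assms(1,3) by (auto simp: in_set_conv_nth nth_eq_iff_index_eq)
    moreover have "z \<in> set v" using that by (rule in_set_takeD)
    ultimately have "cell N (v ! m) \<noteq> cell N z"
      using assms by (auto dest: inj_onD)
    then show ?thesis by (rule cell_less_iff)
  qed
  then show ?thesis
    using assms(3) by (simp add: take_map num_above_map)
qed

text \<open>The entry at position \<open>m\<close> has only \<open>m\<close> predecessors, so its
  process index is at most \<open>m\<close>; depth \<open>n\<close> involves only the first
  \<open>n\<close> processes.\<close>

lemma bump_level_subset_lists:
  assumes "\<And>k. \<xi> k \<in> counting_measures"
  shows "bump_level \<xi> n \<subseteq> {v. set v \<subseteq> (\<Union>k<n. atoms (\<xi> k)) \<and> length v = n}"
proof -
  have "v ! m \<in> (\<Union>k<length v. atoms (\<xi> k))" if v: "v \<in> bump_tree \<xi>" and m: "m < length v" for v m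
  proof -
    have "num_above (take m v) (v ! m) \<le> m" using num_above_le[of "take m v"] m by simp
    with v m show ?thesis
      using bump_tree_iff[OF assms, of v] by (auto intro!: bexI[of _ "num_above (take m v) (v ! m)"])
  qed
  then show ?thesis by (auto simp: bump_level_def in_set_conv_nth)
qed

lemma finite_bump_level:
  assumes "\<And>k. \<xi> k \<in> counting_measures"
  shows "finite (bump_level \<xi> n)"
  by (rule finite_subset[OF bump_level_subset_lists[OF assms] finite_lists_length_eq])
    (auto intro: finite_atoms assms)

text \<open>Picking one atom in each charged cell of \<open>j\<close> gives points in distinct
  cells, hence in the order of the cells. They form a vertex that \<open>map (cell N)\<close> sends
  to \<open>j\<close>, so the vertices cover the occupied lists.\<close>

lemma card_occupied_le:
  assumes "\<And>k. \<xi> k \<in> counting_measures"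
  shows "card {j \<in> cell_lists N n. occupied \<xi> N j} \<le> card (bump_level \<xi> n)"
proof (rule surj_card_le[OF finite_bump_level[OF assms]])
  show "{j \<in> cell_lists N n. occupied \<xi> N j} \<subseteq> map (cell N) ` bump_level \<xi> n"
  proof
    fix j assume "j \<in> {j \<in> cell_lists N n. occupied \<xi> N j}"
    then have j: "length j = n" "distinct j" and occ: "occupied \<xi> N j"
      by (auto simp: cell_lists_def)
    have "\<exists>x. x \<in> atoms (\<xi> (num_above (take m j) (j ! m))) \<and> cell N x = j ! m" if "m < n" for m
      using occ j that emeasure_nonzero_iff_atom[OF assms cell_set_sets]
      by (fastforce simp: occupied_def cell_set_def)
    then obtain x where x: "x m \<in> atoms (\<xi> (num_above (take m j) (j ! m)))" "cell N (x m) = j ! m"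
      if "m < n" for m by metis
    define v where "v = map x [0..<n]"
    have len: "length v = n" by (simp add: v_def)
    have nth: "v ! m = x m" if "m < n" for m using that by (simp add: v_def)
    have jv: "map (cell N) v = j"
      using x j by (auto simp: list_eq_iff_nth_eq v_def)
    have dist: "distinct v" using jv j(2) by (auto simp: distinct_map)
    have inj: "inj_on (cell N) (set v)" using jv j(2) by (auto simp: distinct_map)
    have "v \<in> bump_tree \<xi>"
      unfolding bump_tree_iff[OF assms]
      using dist x num_above_take_map[OF dist inj] nth by (auto simp: len jv)
    then show "j \<in> map (cell N) ` bump_level \<xi> n"
      using jv len by (auto simp: bump_level_def)
  qed
qed

text \<open>Once the cells separate the finitely many atoms involved, \<open>map (cell N)\<close> is
  injective on the level and its values are occupied lists. The threshold for \<open>N\<close>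
  depends on \<open>\<xi>\<close>, so the convergence is only pointwise.\<close>

lemma eventually_card_occupied_eq:
  assumes "\<And>k. \<xi> k \<in> counting_measures"
  shows "\<forall>\<^sub>F N in sequentially.
    card {j \<in> cell_lists N n. occupied \<xi> N j} = card (bump_level \<xi> n)"
proof -
  define A where "A = (\<Union>k<n. atoms (\<xi> k))"
  have "finite A" unfolding A_def by (auto intro: finite_atoms assms)
  moreover have "A \<subseteq> {0..1}"
    unfolding A_def using counting_measures_space[OF assms] by (auto simp: atoms_def)
  ultimately have "\<forall>\<^sub>F N in sequentially. inj_on (cell N) A"
    by (rule eventually_inj_on_cell)
  then show ?thesis
  proof eventually_elim
    case (elim N)
    have sub: "bump_level \<xi> n \<subseteq> {v. set v \<subseteq> A \<and> length v = n}"
      using bump_level_subset_lists[OF assms] by (simp add: A_def)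
    have "card (bump_level \<xi> n) \<le> card {j \<in> cell_lists N n. occupied \<xi> N j}"
    proof (rule card_inj_on_le)
      show "inj_on (map (cell N)) (bump_level \<xi> n)"
        using sub elim
        by (intro inj_on_mapI inj_on_subset[OF elim]) auto
      show "finite {j \<in> cell_lists N n. occupied \<xi> N j}" using finite_cell_lists by simp
      show "map (cell N) ` bump_level \<xi> n \<subseteq> {j \<in> cell_lists N n. occupied \<xi> N j}"
      proof (intro image_subsetI CollectI conjI)
        fix v assume v: "v \<in> bump_level \<xi> n"
        then have tree: "distinct v" "\<And>m. m < n \<Longrightarrow> v ! m \<in> atoms (\<xi> (num_above (take m v) (v ! m)))"
          and len: "length v = n"
          using bump_tree_iff[OF assms, of v] by (auto simp: bump_level_def)
        have inj: "inj_on (cell N) (set v)" using v sub elim by (blast intro: inj_on_subset)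
        show "map (cell N) v \<in> cell_lists N n"
          using tree(1) inj len cell_le[of N] by (auto simp: cell_lists_def distinct_map)
        show "occupied \<xi> N (map (cell N) v)"
          unfolding occupied_def
        proof (intro allI impI)
          fix m assume "m < length (map (cell N) v)"
          then have m: "m < n" "m < length v" using len by auto
          have "v ! m \<in> cell_set N (map (cell N) v ! m)"
            using tree(2)[OF m(1)] m(2) counting_measures_space[OF assms]
            by (auto simp: cell_set_def atoms_def)
          then show "emeasure (\<xi> (num_above (take m (map (cell N) v)) (map (cell N) v ! m)))
              (cell_set N (map (cell N) v ! m)) \<noteq> 0"
            unfolding num_above_take_map[OF tree(1) inj m(2)]
              emeasure_nonzero_iff_atom[OF assms cell_set_sets]
            using tree(2)[OF m(1)] by blast
        qed
      qed
    qed
    with card_occupied_le[of \<xi>, OF assms, of N n] show ?case by simp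
  qed
qed

text \<open>Countable additivity over the depths. Finiteness of each level matters, as
  \<open>card\<close> of an infinite set is 0.\<close>

lemma bump_tree_size_eq_suminf:
  assumes "\<And>k. \<xi> k \<in> counting_measures"
  shows "bump_tree_size \<xi> = (\<Sum>n. of_nat (card (bump_level \<xi> n)))"
proof -
  have "(\<Sum>n. emeasure (count_space UNIV) (bump_level \<xi> n)) =
      emeasure (count_space UNIV) (\<Union>n. bump_level \<xi> n)"
    by (rule suminf_emeasure) (auto simp: disjoint_family_on_def bump_level_def)
  also have "(\<Union>n. bump_level \<xi> n) = bump_tree \<xi>" by (auto simp: bump_level_def)
  finally show ?thesis
    using finite_bump_level[of \<xi>, OF assms] by (simp add: bump_tree_size_def emeasure_count_space)
qed

section \<open>Occupation probabilities and their limit\<close>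

lemma measurable_emeasure_counting_algebra [measurable]:
  assumes "E \<in> sets unit_borel"
  shows "(\<lambda>\<mu>. emeasure \<mu> E) \<in> borel_measurable counting_algebra"
  unfolding counting_algebra_def
  by (rule measurable_Sup1[OF _ measurable_vimage_algebra1]) (use assms in auto)

text \<open>The \<open>n\<close> factors of the falling factorial are paired with the
  \<open>n\<close> equal probabilities; each pair tends to \<alpha> because
  \<open>1 - exp (- t)\<close> behaves like \<open>t\<close> near 0.\<close>

lemma expected_cells_tendsto:
  "(\<lambda>N. real (card (cell_lists N n)) * (1 - exp (- (\<alpha> / Suc N))) ^ n) \<longlonglongrightarrow> \<alpha> ^ n"
proof -
  have "(\<lambda>N. (real (Suc N) - real i) * (1 - exp (- (\<alpha> / Suc N)))) \<longlonglongrightarrow> \<alpha>" for i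
    by real_asymp
  then have "(\<lambda>N. \<Prod>i<n. (real (Suc N) - real i) * (1 - exp (- (\<alpha> / Suc N)))) \<longlonglongrightarrow> (\<Prod>i<n. \<alpha>)"
    by (intro tendsto_prod) auto
  moreover have "\<forall>\<^sub>F N in sequentially. (\<Prod>i<n. (real (Suc N) - real i) * (1 - exp (- (\<alpha> / Suc N))))
      = real (card (cell_lists N n)) * (1 - exp (- (\<alpha> / Suc N))) ^ n"
    using eventually_ge_at_top[of n]
    by eventually_elim (simp add: card_cell_lists prod.distrib del: of_nat_Suc)
  ultimately show ?thesis by (auto intro: Lim_transform_eventually)
qed


lemma (in prob_space) poisson_prob_nonzero:
  assumes N: "poisson_point_process M \<alpha> N" and E: "E \<in> sets unit_borel"
  shows "prob ((\<lambda>\<omega>. emeasure (N \<omega>) E) -` (- {0}) \<inter> space M) = 1 - exp (- (\<alpha> * measure lborel E))"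
proof -
  have [measurable]: "N \<in> measurable M counting_algebra"
    using N by (simp add: poisson_point_process_def)
  note [measurable] = measurable_emeasure_counting_algebra[OF E]
  have ev: "{\<omega>\<in>space M. emeasure (N \<omega>) E = 0} \<in> events" by measurable
  have "(\<lambda>\<omega>. emeasure (N \<omega>) E) -` (- {0}) \<inter> space M = {\<omega>\<in>space M. \<not> emeasure (N \<omega>) E = 0}"
    by auto
  then have "prob ((\<lambda>\<omega>. emeasure (N \<omega>) E) -` (- {0}) \<inter> space M) =
      1 - prob {\<omega>\<in>space M. emeasure (N \<omega>) E = 0}"
    using prob_neg[OF ev] by simp
  also have "prob {\<omega>\<in>space M. emeasure (N \<omega>) E = 0} = exp (- (\<alpha> * measure lborel E))"
  proof -
    have "\<forall>n::nat. prob {\<omega>\<in>space M. emeasure (N \<omega>) E = of_nat n} =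
        exp (- (\<alpha> * measure lborel E)) * (\<alpha> * measure lborel E) ^ n / fact n"
      using N E unfolding poisson_point_process_def by blast
    from spec[OF this, of 0] show ?thesis by simp
  qed
  finally show ?thesis .
qed

lemma (in prob_space) poisson_prob_all_nonzero:
  assumes N: "poisson_point_process M \<alpha> N"
    and E: "\<And>i. E i \<in> sets unit_borel" "disjoint_family (E :: nat \<Rightarrow> real set)" and J: "finite J"
  shows "prob {\<omega>\<in>space M. \<forall>i\<in>J. emeasure (N \<omega>) (E i) \<noteq> 0} =
    (\<Prod>i\<in>J. 1 - exp (- (\<alpha> * measure lborel (E i))))"
\<comment> \<open>With \<open>J\<close> empty the intersection used below would be the whole type
  instead of \<open>space M\<close>.\<close>
proof (cases "J = {}")
  case True
  then show ?thesis by (simp add: prob_space)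
next
  case False
  have "indep_vars (\<lambda>_. borel) (\<lambda>i \<omega>. emeasure (N \<omega>) (E i)) UNIV"
    using N E by (auto simp: poisson_point_process_def)
  then have "prob (\<Inter>i\<in>J. (\<lambda>\<omega>. emeasure (N \<omega>) (E i)) -` (- {0}) \<inter> space M) =
      (\<Prod>i\<in>J. prob ((\<lambda>\<omega>. emeasure (N \<omega>) (E i)) -` (- {0}) \<inter> space M))"
    using False J by (intro indep_varsD) auto
  moreover have "(\<Inter>i\<in>J. (\<lambda>\<omega>. emeasure (N \<omega>) (E i)) -` (- {0}) \<inter> space M) =
      {\<omega>\<in>space M. \<forall>i\<in>J. emeasure (N \<omega>) (E i) \<noteq> 0}"
    using False by auto
  ultimately show ?thesis by (simp add: poisson_prob_nonzero[OF N E(1)])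
qed

lemma (in prob_space) occupied_event:
  assumes "\<And>k. \<xi> k \<in> measurable M counting_algebra"
  shows "{\<omega>\<in>space M. occupied (\<lambda>k. \<xi> k \<omega>) N j} \<in> events"
proof -
  note [measurable] = assms measurable_emeasure_counting_algebra[OF cell_set_sets]
  show ?thesis unfolding occupied_def by measurable
qed

text \<open>Independence enters twice: between the processes, and within one process between
  disjoint cells. Positions are therefore grouped by the index of their process.\<close>

lemma (in prob_space) prob_occupied:
  assumes PP: "\<And>k. poisson_point_process M \<alpha> (\<xi> k)"
    and ind: "indep_vars (\<lambda>_. counting_algebra) \<xi> UNIV"
    and j: "j \<in> cell_lists N n"
  shows "prob {\<omega>\<in>space M. occupied (\<lambda>k. \<xi> k \<omega>) N j} = (1 - exp (- (\<alpha> / Suc N))) ^ n"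
proof -
  have len: "length j = n" and dist: "distinct j" and sub: "set j \<subseteq> {..N}"
    using j by (auto simp: cell_lists_def)
  define r where "r m = num_above (take m j) (j ! m)" for m
  have r_le: "r m \<le> n" if "m < n" for m
    using num_above_le[of "take m j" "j ! m"] that len by (simp add: r_def)
  define S where "S k = {m \<in> {..<n}. r m = k}" for k
  have S: "finite (S k)" for k by (simp add: S_def)
  \<comment> \<open>Padding by empty sets makes the finitely many cells an infinite disjoint
    sequence, the form in which a Poisson process has independent counts.\<close>
  define E where "E m = (if m < n then cell_set N (j ! m) else {})" for m
  have E: "E m \<in> sets unit_borel" for m by (simp add: E_def cell_set_sets)
  have dE: "disjoint_family E"
    using disjoint_cell_set[of N] dist len
    by (auto simp: disjoint_family_on_def E_def nth_eq_iff_index_eq)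
  define A where "A k = {\<mu>\<in>space counting_algebra. \<forall>m\<in>S k. emeasure \<mu> (E m) \<noteq> 0}" for k
  note [measurable] = measurable_emeasure_counting_algebra[OF E]
  have A: "A k \<in> sets counting_algebra" for k
    unfolding A_def using S by measurable
  have sp: "\<xi> k \<omega> \<in> space counting_algebra" if "\<omega> \<in> space M" for k \<omega>
    using PP[of k] that by (auto simp: poisson_point_process_def dest: measurable_space)
  \<comment> \<open>If no position uses process \<open>k\<close>, then \<open>A k\<close> is the
    whole space. The range \<open>{..n}\<close> is nonempty even for \<open>n = 0\<close>.\<close>
  have "{\<omega>\<in>space M. occupied (\<lambda>k. \<xi> k \<omega>) N j} = (\<Inter>k\<in>{..n}. \<xi> k -` A k \<inter> space M)"
    using sp r_le by (auto simp: occupied_def A_def S_def E_def len r_def)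
  also have "prob \<dots> = (\<Prod>k\<le>n. prob (\<xi> k -` A k \<inter> space M))"
    using A by (intro indep_varsD[OF ind]) auto
  also have "\<dots> = (\<Prod>k\<le>n. \<Prod>m\<in>S k. 1 - exp (- (\<alpha> / Suc N)))"
  proof (rule prod.cong[OF refl])
    fix k
    have "\<xi> k -` A k \<inter> space M = {\<omega>\<in>space M. \<forall>m\<in>S k. emeasure (\<xi> k \<omega>) (E m) \<noteq> 0}"
      using sp by (auto simp: A_def)
    then have "prob (\<xi> k -` A k \<inter> space M) = (\<Prod>m\<in>S k. 1 - exp (- (\<alpha> * measure lborel (E m))))"
      using poisson_prob_all_nonzero[OF PP E dE S] by simp
    also have "\<dots> = (\<Prod>m\<in>S k. 1 - exp (- (\<alpha> / Suc N)))"
    proof (rule prod.cong[OF refl])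
      fix m assume "m \<in> S k"
      then have "m < n" by (simp add: S_def)
      moreover from this have "j ! m \<le> N" using sub len by (auto dest: nth_mem)
      ultimately show "1 - exp (- (\<alpha> * measure lborel (E m))) = 1 - exp (- (\<alpha> / Suc N))"
        by (simp add: E_def measure_cell_set)
    qed
    finally show "prob (\<xi> k -` A k \<inter> space M) = (\<Prod>m\<in>S k. 1 - exp (- (\<alpha> / Suc N)))" .
  qed
  \<comment> \<open>Every position below \<open>n\<close> lies in exactly one group
    \<open>S k\<close>.\<close>
  also have "\<dots> = (\<Prod>m<n. 1 - exp (- (\<alpha> / Suc N)))"
    unfolding S_def using r_le by (intro prod.group) auto
  finally show ?thesis by simp
qed

section \<open>Expected number of vertices of one depth\<close>

lemma (in prob_space) expected_card_bump_level:
  assumes PP: "\<And>k. poisson_point_process M \<alpha> (\<xi> k)"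
    and ind: "indep_vars (\<lambda>_. counting_algebra) \<xi> UNIV"
    and \<alpha>: "0 \<le> \<alpha>"
  shows "(\<lambda>\<omega>. of_nat (card (bump_level (\<lambda>k. \<xi> k \<omega>) n)) :: ennreal) \<in> borel_measurable M" (is ?meas)
    and "(\<integral>\<^sup>+ \<omega>. of_nat (card (bump_level (\<lambda>k. \<xi> k \<omega>) n)) \<partial>M) = ennreal (\<alpha> ^ n)" (is ?int)
proof -
  have meas: "\<xi> k \<in> measurable M counting_algebra" for k
    using PP[of k] by (simp add: poisson_point_process_def)
  have conf: "\<xi> k \<omega> \<in> counting_measures" if "\<omega> \<in> space M" for k \<omega>
    using measurable_space[OF meas that] by (simp add: space_counting_algebra)
  define ev where "ev N j = {\<omega>\<in>space M. occupied (\<lambda>k. \<xi> k \<omega>) N j}" for N j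
  have ev [measurable]: "ev N j \<in> events" for N j
    unfolding ev_def by (rule occupied_event[OF meas])
  let ?Z = "\<lambda>\<omega>. of_nat (card (bump_level (\<lambda>k. \<xi> k \<omega>) n)) :: ennreal"
  \<comment> \<open>As a sum of indicators of events, the number of occupied lists is measurable and
    its integral is a sum of probabilities.\<close>
  define X :: "nat \<Rightarrow> 'a \<Rightarrow> ennreal"
    where "X N \<omega> = (\<Sum>j\<in>cell_lists N n. indicator (ev N j) \<omega>)" for N \<omega>
  have X [measurable]: "X N \<in> borel_measurable M" for N
    unfolding X_def by measurable
  have X_card: "X N \<omega> = (of_nat (card {j\<in>cell_lists N n. occupied (\<lambda>k. \<xi> k \<omega>) N j}) :: ennreal)"
    if "\<omega> \<in> space M" for N \<omega>
    using that finite_cell_lists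
    by (simp add: X_def ev_def indicator_def sum.If_cases Int_def)
  have X_le: "X N \<omega> \<le> ?Z \<omega>" if "\<omega> \<in> space M" for N \<omega>
    using card_occupied_le[of "\<lambda>k. \<xi> k \<omega>", OF conf[OF that]] by (simp add: X_card[OF that])
  have X_lim: "(\<lambda>N. X N \<omega>) \<longlonglongrightarrow> ?Z \<omega>" if "\<omega> \<in> space M" for \<omega>
    using eventually_card_occupied_eq[of "\<lambda>k. \<xi> k \<omega>" n, OF conf[OF that]]
    by (intro tendsto_eventually) (auto simp: X_card[OF that] elim!: eventually_mono)
  \<comment> \<open>Writing the limit as a \<open>liminf\<close> yields measurability of the level
    count and the form needed for Fatou's lemma.\<close>
  have Z_eq: "?Z \<omega> = liminf (\<lambda>N. X N \<omega>)" if "\<omega> \<in> space M" for \<omega>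
    using X_lim[OF that] by (simp add: lim_imp_Liminf)
  show ?meas
    by (subst measurable_cong[OF Z_eq]) auto
  have X_int: "(\<integral>\<^sup>+ \<omega>. X N \<omega> \<partial>M) = ennreal (real (card (cell_lists N n)) * (1 - exp (- (\<alpha> / Suc N))) ^ n)" for N
  proof -
    have "(\<integral>\<^sup>+ \<omega>. X N \<omega> \<partial>M) = (\<Sum>j\<in>cell_lists N n. emeasure M (ev N j))"
      unfolding X_def by (subst nn_integral_sum) auto
    also have "\<dots> = (\<Sum>j\<in>cell_lists N n. ennreal ((1 - exp (- (\<alpha> / Suc N))) ^ n))"
      using prob_occupied[OF PP ind] by (intro sum.cong) (simp_all add: emeasure_eq_measure ev_def)
    also have "\<dots> = ennreal (real (card (cell_lists N n)) * (1 - exp (- (\<alpha> / Suc N))) ^ n)"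
      using \<alpha> by (simp add: ennreal_mult ennreal_of_nat_eq_real_of_nat)
    finally show ?thesis .
  qed
  have X_int_lim: "(\<lambda>N. \<integral>\<^sup>+ \<omega>. X N \<omega> \<partial>M) \<longlonglongrightarrow> ennreal (\<alpha> ^ n)"
    unfolding X_int by (intro tendsto_ennrealI expected_cells_tendsto)
  show ?int
  proof (rule antisym)
    have "(\<integral>\<^sup>+ \<omega>. ?Z \<omega> \<partial>M) = (\<integral>\<^sup>+ \<omega>. liminf (\<lambda>N. X N \<omega>) \<partial>M)"
      by (rule nn_integral_cong[OF Z_eq])
    also have "\<dots> \<le> liminf (\<lambda>N. \<integral>\<^sup>+ \<omega>. X N \<omega> \<partial>M)"
      by (rule nn_integral_liminf) simp
    also have "\<dots> = ennreal (\<alpha> ^ n)"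
      using X_int_lim by (simp add: lim_imp_Liminf)
    finally show "(\<integral>\<^sup>+ \<omega>. ?Z \<omega> \<partial>M) \<le> ennreal (\<alpha> ^ n)" .
    \<comment> \<open>Each \<open>X N\<close> lies below the level count, so the limit of the
      integrals does not exceed its integral.\<close>
    show "ennreal (\<alpha> ^ n) \<le> (\<integral>\<^sup>+ \<omega>. ?Z \<omega> \<partial>M)"
      using X_le by (intro LIMSEQ_le_const2[OF X_int_lim] exI[of _ 0] allI impI nn_integral_mono)
  qed
qed

section \<open>Summation over all depths\<close>

theorem theorem1:
  fixes M :: "'w measure" and \<alpha> :: real and \<xi> :: "nat \<Rightarrow> 'w \<Rightarrow> real measure"
  assumes "prob_space M"
    and "0 < \<alpha>" "\<alpha> \<le> 1"
    and "\<And>k. poisson_point_process M \<alpha> (\<xi> k)"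
    and "prob_space.indep_vars M (\<lambda>_. counting_algebra) \<xi> UNIV"
  shows "(\<lambda>\<omega>. bump_tree_size (\<lambda>k. \<xi> k \<omega>)) \<in> borel_measurable M \<and>
    (\<alpha> < 1 \<longrightarrow> (\<integral>\<^sup>+ \<omega>. bump_tree_size (\<lambda>k. \<xi> k \<omega>) \<partial>M) = ennreal (1 / (1 - \<alpha>))) \<and>
    (\<alpha> = 1 \<longrightarrow> (\<integral>\<^sup>+ \<omega>. bump_tree_size (\<lambda>k. \<xi> k \<omega>) \<partial>M) = \<infinity>)"
proof -
  interpret prob_space M by fact
  note level = expected_card_bump_level[of \<alpha> \<xi>, OF assms(4,5) less_imp_le[OF assms(2)]]
  have conf: "\<xi> k \<omega> \<in> counting_measures" if "\<omega> \<in> space M" for k \<omega>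
    using assms(4)[of k] measurable_space[OF _ that, of "\<xi> k" counting_algebra]
    by (simp add: poisson_point_process_def space_counting_algebra)
  have size: "bump_tree_size (\<lambda>k. \<xi> k \<omega>) = (\<Sum>n. of_nat (card (bump_level (\<lambda>k. \<xi> k \<omega>) n)))"
    if "\<omega> \<in> space M" for \<omega>
    by (rule bump_tree_size_eq_suminf) (rule conf[OF that])
  have meas: "(\<lambda>\<omega>. bump_tree_size (\<lambda>k. \<xi> k \<omega>)) \<in> borel_measurable M"
    using level(1) by (subst measurable_cong[OF size]) auto
  \<comment> \<open>All terms are nonnegative and measurable, so sum and integral may be
    exchanged.\<close>
  have int: "(\<integral>\<^sup>+ \<omega>. bump_tree_size (\<lambda>k. \<xi> k \<omega>) \<partial>M) = (\<Sum>n. ennreal (\<alpha> ^ n))"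
    using level by (simp add: nn_integral_suminf size cong: nn_integral_cong)
  have "(\<Sum>n. ennreal (\<alpha> ^ n)) = ennreal (1 / (1 - \<alpha>))" if "\<alpha> < 1"
    using that assms(2)
    by (subst suminf_ennreal2) (auto simp: suminf_geometric summable_geometric)
  \<comment> \<open>At the critical intensity every depth contributes 1, and a nonzero constant
    series is not summable.\<close>
  moreover have "(\<Sum>n. ennreal (\<alpha> ^ n)) = \<infinity>" if "\<alpha> = 1"
    using that summable_iff_suminf_neq_top[of "\<lambda>n. \<alpha> ^ n"] by (simp add: summable_const_iff)
  ultimately show ?thesis using meas int by simp
qed

end
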